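(* Let $\lambda\in\mathbb{R}\setminus\{0\}$, $B_\lambda(z)=(1+\lambda z)^{1/\lambda}$ and $C_\lambda(z)=\exp\left(\frac1\lambda\big((1+z)^\lambda-1\big)\right)$. Then for all $n\ge k\ge0$, \[ \delta_{n,k}=\sum_{j=k}^{n}S_{B_\lambda}(n,j)s_{C_\lambda}(j,k),\qquad s(n,k)=\sum_{j=k}^{n}s_{C_\lambda}(n,j)\lambda^{j-k}s(j,k), \] and for all $x\in\mathbb{R}$, \[ (x)_n=\sum_{k=0}^{n}s_{C_\lambda}(n,k)(x)_{k,\lambda}. \]
   Context: Powers $(1+w)^{a}=\exp(a\log(1+w))$ with principal logarithm, for $w$ near $0$. For $F$ analytic at $0$ with $F(0)=1$, $\log F$ is the branch with $\log F(0)=0$ near $0$, and $F$-Stirling numbers are defined by $\frac{(\log F(z))^k}{k!}=\sum_{n\ge k}s_F(n,k)\frac{z^n}{n!}$ and $\frac{(F(z)-1)^k}{k!}=\sum_{n\ge k}S_F(n,k)\frac{z^n}{n!}$. $s(n,k)$ are the signed Stirling numbers of the first kind: $\frac{(\log(1+z))^k}{k!}=\sum_{n\ge k}s(n,k)\frac{z^n}{n!}$. $\delta_{n,k}$ is the Kronecker delta. $(x)_n=x(x-1)\cdots(x-n+1)$, $(x)_0=1$, and $(x)_{k,\lambda}=x(x-\lambda)\cdots(x-(k-1)\lambda)$ for $k\ge1$, $(x)_{0,\lambda}=1$. *)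

theory Defs
  imports "HOL-Complex_Analysis.Complex_Analysis"
begin

definition egf_coeff :: "(complex \<Rightarrow> complex) \<Rightarrow> nat \<Rightarrow> complex" where
  "egf_coeff f n = fact n * fps_nth (fps_expansion f 0) n"

text \<open>
  For \<open>F\<close> continuous at \<open>0\<close> with \<open>F 0 = 1\<close>, the branch of \<open>log F\<close> near \<open>0\<close> that vanishes
  at \<open>0\<close> is \<open>Ln (F z)\<close>. Only the germ at \<open>0\<close> enters the coefficients.
\<close>

definition stirling1_F :: "(complex \<Rightarrow> complex) \<Rightarrow> nat \<Rightarrow> nat \<Rightarrow> complex" where
  "stirling1_F F n k = egf_coeff (\<lambda>z. Ln (F z) ^ k / fact k) n"

definition stirling2_F :: "(complex \<Rightarrow> complex) \<Rightarrow> nat \<Rightarrow> nat \<Rightarrow> complex" where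
  "stirling2_F F n k = egf_coeff (\<lambda>z. (F z - 1) ^ k / fact k) n"

definition signed_stirling1 :: "nat \<Rightarrow> nat \<Rightarrow> complex" where
  "signed_stirling1 n k = egf_coeff (\<lambda>z. Ln (1 + z) ^ k / fact k) n"

definition B_fun :: "real \<Rightarrow> complex \<Rightarrow> complex" where
  "B_fun l z = (1 + of_real l * z) powr (1 / of_real l)"

definition C_fun :: "real \<Rightarrow> complex \<Rightarrow> complex" where
  "C_fun l z = exp (1 / of_real l * ((1 + z) powr of_real l - 1))"

definition ffact :: "real \<Rightarrow> nat \<Rightarrow> real" where
  "ffact x n = (\<Prod>i<n. x - of_nat i)"

definition ffact_step :: "real \<Rightarrow> nat \<Rightarrow> real \<Rightarrow> real" where
  "ffact_step x k l = (\<Prod>i<k. x - of_nat i * l)"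

text \<open>
  The coefficients are exactly those determined by the generating functions.
\<close>

lemma egf_coeff_sums:
  assumes "f analytic_on {0}"
  shows "\<forall>\<^sub>F z in nhds 0. (\<lambda>n. egf_coeff f n * z ^ n / fact n) sums f z"
proof -
  have *: "f has_fps_expansion fps_expansion f 0"
    using assms by (rule analytic_at_imp_has_fps_expansion_0)
  then have "\<forall>\<^sub>F z in nhds 0. z \<in> eball 0 (fps_conv_radius (fps_expansion f 0))"
    by (intro eventually_nhds_in_open) (auto simp: has_fps_expansion_def zero_ereal_def)
  moreover have "\<forall>\<^sub>F z in nhds 0. eval_fps (fps_expansion f 0) z = f z"
    using * by (auto simp: has_fps_expansion_def)
  ultimately show ?thesis
  proof eventually_elim
    case (elim z)
    then have "(\<lambda>n. fps_nth (fps_expansion f 0) n * z ^ n) sums f z"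
      using sums_eval_fps[of z "fps_expansion f 0"] by (simp add: in_eball_iff)
    then show ?case by (simp add: egf_coeff_def)
  qed
qed

lemma egf_coeff_unique:
  assumes "\<forall>\<^sub>F z in nhds 0. (\<lambda>n. a n * z ^ n / fact n) sums f z"
  shows "a n = egf_coeff f n"
proof -
  have "f has_fps_expansion Abs_fps (\<lambda>n. a n / fact n)"
    using assms by (intro has_fps_expansionI) (simp add: field_simps)
  then have "fps_nth (Abs_fps (\<lambda>n. a n / fact n)) n = (deriv ^^ n) f 0 / fact n"
    by (rule fps_nth_fps_expansion)
  then show ?thesis by (simp add: egf_coeff_def fps_expansion_def)
qed

lemma egf_coeff_power_eq_0:
  assumes "g analytic_on {0}" "g 0 = 0" "n < k"
  shows "egf_coeff (\<lambda>z. g z ^ k / fact k) n = 0"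
proof -
  define G where "G = fps_expansion g 0"
  have G: "g has_fps_expansion G"
    unfolding G_def using assms(1) by (rule analytic_at_imp_has_fps_expansion_0)
  have G0: "fps_nth G 0 = 0"
    using assms(2) by (simp add: G_def fps_expansion_def)
  have "(\<lambda>z. g z ^ k * (1 / fact k)) has_fps_expansion G ^ k * fps_const (1 / fact k)"
    by (intro fps_expansion_intros G)
  then have "(\<lambda>z. g z ^ k / fact k) has_fps_expansion G ^ k * fps_const (1 / fact k)"
    by simp
  then have "fps_nth (G ^ k * fps_const (1 / fact k)) n =
      (deriv ^^ n) (\<lambda>z. g z ^ k / fact k) 0 / fact n"
    by (rule fps_nth_fps_expansion)
  moreover have "fps_nth (G ^ k) n = 0"
    using G0 assms(3) startsby_zero_power_prefix by blast
  ultimately show ?thesis by (simp add: egf_coeff_def fps_expansion_def)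
qed

lemma analytic_Ln_F:
  assumes "F analytic_on {0}" "F 0 = 1"
  shows "(\<lambda>z. Ln (F z)) analytic_on {0}"
  using assms by (intro analytic_intros) auto

lemma stirling1_F_sums:
  assumes "F analytic_on {0}" "F 0 = 1"
  shows "\<forall>\<^sub>F z in nhds 0. (\<lambda>n. stirling1_F F n k * z ^ n / fact n) sums (Ln (F z) ^ k / fact k)"
    and "n < k \<Longrightarrow> stirling1_F F n k = 0"
  unfolding stirling1_F_def
  using assms
  by (auto intro!: egf_coeff_sums egf_coeff_power_eq_0 analytic_Ln_F analytic_intros)

lemma stirling2_F_sums:
  assumes "F analytic_on {0}" "F 0 = 1"
  shows "\<forall>\<^sub>F z in nhds 0. (\<lambda>n. stirling2_F F n k * z ^ n / fact n) sums ((F z - 1) ^ k / fact k)"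
    and "n < k \<Longrightarrow> stirling2_F F n k = 0"
  unfolding stirling2_F_def
  using assms
  by (auto intro!: egf_coeff_sums egf_coeff_power_eq_0 analytic_intros)

lemma B_fun_analytic: "B_fun l analytic_on {0}" and B_fun_0: "B_fun l 0 = 1"
proof -
  have "(\<lambda>z. (1 + of_real l * z) powr (1 / of_real l)) analytic_on {0}"
    by (cases "l = 0") (auto intro!: analytic_intros)
  then show "B_fun l analytic_on {0}" by (simp add: B_fun_def[abs_def])
qed (simp add: B_fun_def)

lemma C_fun_analytic: "C_fun l analytic_on {0}" and C_fun_0: "C_fun l 0 = 1"
proof -
  have "(\<lambda>z. exp (1 / of_real l * ((1 + z) powr of_real l - 1))) analytic_on {0}"
    by (cases "l = 0") (auto intro!: analytic_intros)
  then show "C_fun l analytic_on {0}" by (simp add: C_fun_def[abs_def])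
qed (simp add: C_fun_def)

end

theory Submission
  imports Defs
begin

text \<open>
  Comtet's iteration matrix \<open>[z\<^sup>n/n!] (g\<^sup>k/k!)\<close> of a germ \<open>g\<close> with \<open>g 0 = 0\<close> turns composition of
  germs into multiplication of lower triangular matrices. The matrices \<open>s\<^sub>F\<close> and \<open>S\<^sub>F\<close> are the
  iteration matrices of \<open>Ln F\<close> and \<open>F - 1\<close>. Near \<open>0\<close> one has \<open>Ln (C (B z - 1)) = z\<close> and
  \<open>B (Ln (C z)) = 1 + z\<close>. The first relation says \<open>S\<^sub>B s\<^sub>C = 1\<close>, and taking \<open>Ln\<close> in the second gives
  \<open>s = s\<^sub>C s\<^sub>B\<close>, where \<open>s\<^sub>B(j,k) = l\<^bsup>j-k\<^esup> s(j,k)\<close> because \<open>Ln (B w) = Ln (1 + l w)/l\<close>. Raising the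
  second relation to the power \<open>x\<close> and expanding \<open>B\<^sup>x\<close> in powers of \<open>Ln C\<close> gives the last identity.
\<close>

section \<open>Coefficients of exponential generating functions\<close>

lemma has_fps_expansion_imp_egf_coeff:
  assumes "f has_fps_expansion F"
  shows "egf_coeff f n = fact n * fps_nth F n"
  using fps_nth_fps_expansion[OF assms, of n] by (simp add: egf_coeff_def fps_expansion_def)

lemma egf_coeff_cong:
  assumes "\<forall>\<^sub>F z in nhds 0. f z = g z"
  shows "egf_coeff f n = egf_coeff g n"
  using fps_expansion_cong[OF assms] by (simp add: egf_coeff_def)

lemma egf_coeff_cmult:
  assumes "f analytic_on {0}"
  shows "egf_coeff (\<lambda>z. c * f z) n = c * egf_coeff f n"
proof -
  obtain F where F: "f has_fps_expansion F"
    using analytic_at_imp_has_fps_expansion_0[OF assms] by blast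
  from has_fps_expansion_cmult_left[OF this, of c] show ?thesis
    by (simp add: has_fps_expansion_imp_egf_coeff[OF F] has_fps_expansion_imp_egf_coeff)
qed

lemma egf_coeff_scale:
  assumes "f analytic_on {0}"
  shows "egf_coeff (\<lambda>z. f (c * z)) n = c ^ n * egf_coeff f n"
proof -
  obtain F where F: "f has_fps_expansion F"
    using analytic_at_imp_has_fps_expansion_0[OF assms] by blast
  have "(\<lambda>z. c * z) has_fps_expansion fps_const c * fps_X"
    by (intro fps_expansion_intros)
  from has_fps_expansion_compose[OF F this]
  have "(\<lambda>z. f (c * z)) has_fps_expansion (F oo fps_const c * fps_X)"
    by (simp add: o_def)
  then show ?thesis
    by (simp add: has_fps_expansion_imp_egf_coeff[OF F] has_fps_expansion_imp_egf_coeff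
        fps_compose_linear)
qed

lemma egf_coeff_powr_linear:
  "egf_coeff (\<lambda>z. (1 + c * z) powr a) n = (\<Prod>i<n. c * (a - of_nat i))"
proof -
  have "egf_coeff (\<lambda>z. (1 + z) powr a) n = (\<Prod>i<n. a - of_nat i)"
    using has_fps_expansion_imp_egf_coeff[OF has_fps_expansion_binomial_complex]
    by (simp add: gbinomial_mult_fact lessThan_atLeast0)
  moreover have "(\<lambda>z. (1 + z) powr a) analytic_on {0}"
    by (intro analytic_intros) auto
  ultimately show ?thesis
    using egf_coeff_scale[of "\<lambda>z. (1 + z) powr a" c n] by (simp add: prod.distrib)
qed

section \<open>Iteration matrices\<close>

definition iteration_matrix :: "(complex \<Rightarrow> complex) \<Rightarrow> nat \<Rightarrow> nat \<Rightarrow> complex" where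
  "iteration_matrix g n k = egf_coeff (\<lambda>z. g z ^ k / fact k) n"

lemma iteration_matrix_cong:
  assumes "\<forall>\<^sub>F z in nhds 0. f z = g z"
  shows "iteration_matrix f n k = iteration_matrix g n k"
  unfolding iteration_matrix_def
  by (rule egf_coeff_cong) (use assms in \<open>eventually_elim, simp\<close>)

lemma has_fps_expansion_imp_iteration_matrix:
  assumes "g has_fps_expansion G"
  shows "iteration_matrix g n k = fact n * fps_nth (G ^ k) n / fact k"
proof -
  have "(\<lambda>z. g z ^ k * (1 / fact k)) has_fps_expansion G ^ k * fps_const (1 / fact k)"
    by (intro fps_expansion_intros assms)
  from has_fps_expansion_imp_egf_coeff[OF this] show ?thesis
    by (simp add: iteration_matrix_def)
qed

lemma iteration_matrix_ident: "iteration_matrix (\<lambda>z. z) n k = (if n = k then 1 else 0)"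
  by (simp add: has_fps_expansion_imp_iteration_matrix[OF has_fps_expansion_fps_X] fps_X_power_nth)

lemma iteration_matrix_rescale:
  assumes "g analytic_on {0}" "c \<noteq> 0" "k \<le> n"
  shows "iteration_matrix (\<lambda>z. g (c * z) / c) n k = c ^ (n - k) * iteration_matrix g n k"
proof -
  have power_analytic: "(\<lambda>z. g z ^ k / fact k) analytic_on {0}"
    using assms(1) by (intro analytic_intros) auto
  have "(\<lambda>z. g (c * z)) analytic_on {0}"
    using analytic_on_compose[of "\<lambda>z. c * z" "{0}" g] assms(1)
    by (auto simp: o_def intro!: analytic_intros)
  then have "(\<lambda>z. g (c * z) ^ k / fact k) analytic_on {0}"
    by (intro analytic_intros) auto
  then have "egf_coeff (\<lambda>z. 1 / c ^ k * (g (c * z) ^ k / fact k)) n =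
      1 / c ^ k * (c ^ n * iteration_matrix g n k)"
    by (simp only: egf_coeff_cmult egf_coeff_scale[OF power_analytic] iteration_matrix_def)
  then show ?thesis
    using assms(2,3) by (simp add: iteration_matrix_def power_divide power_diff field_simps)
qed

lemma egf_coeff_compose:
  assumes f: "f analytic_on {0}" and g: "g analytic_on {0}" "g 0 = 0"
  shows "egf_coeff (\<lambda>z. f (g z)) n = (\<Sum>j=0..n. iteration_matrix g n j * egf_coeff f j)"
proof -
  obtain F where F: "f has_fps_expansion F"
    using analytic_at_imp_has_fps_expansion_0[OF f] by blast
  obtain G where G: "g has_fps_expansion G"
    using analytic_at_imp_has_fps_expansion_0[OF g(1)] by blast
  have "fps_nth G 0 = 0"
    using has_fps_expansion_imp_0_eq_fps_nth_0[OF G] g(2) by simp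
  then have "(\<lambda>z. f (g z)) has_fps_expansion (F oo G)"
    using has_fps_expansion_compose[OF F G] by (simp add: o_def)
  then have "egf_coeff (\<lambda>z. f (g z)) n = (\<Sum>j=0..n. fact n * (fps_nth F j * fps_nth (G ^ j) n))"
    by (simp add: has_fps_expansion_imp_egf_coeff fps_compose_nth sum_distrib_left)
  also have "\<dots> = (\<Sum>j=0..n. iteration_matrix g n j * egf_coeff f j)"
    by (simp add: has_fps_expansion_imp_iteration_matrix[OF G]
        has_fps_expansion_imp_egf_coeff[OF F] mult_ac)
  finally show ?thesis .
qed

lemma iteration_matrix_compose:
  assumes f: "f analytic_on {0}" "f 0 = 0" and g: "g analytic_on {0}" "g 0 = 0"
  shows "iteration_matrix (\<lambda>z. f (g z)) n k =
    (\<Sum>j=k..n. iteration_matrix g n j * iteration_matrix f j k)"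
proof -
  have "(\<lambda>z. f z ^ k / fact k) analytic_on {0}"
    using f(1) by (intro analytic_intros) auto
  from egf_coeff_compose[OF this g]
  have "iteration_matrix (\<lambda>z. f (g z)) n k =
      (\<Sum>j=0..n. iteration_matrix g n j * iteration_matrix f j k)"
    by (simp add: iteration_matrix_def)
  also have "\<dots> = (\<Sum>j=k..n. iteration_matrix g n j * iteration_matrix f j k)"
    by (rule sum.mono_neutral_right)
       (auto simp: iteration_matrix_def[of f] egf_coeff_power_eq_0[OF f])
  finally show ?thesis .
qed

section \<open>Stirling matrices\<close>

lemma stirling1_F_eq_iteration_matrix:
  "stirling1_F F n k = iteration_matrix (\<lambda>z. Ln (F z)) n k"
  by (simp add: stirling1_F_def iteration_matrix_def)

lemma stirling2_F_eq_iteration_matrix: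
  "stirling2_F F n k = iteration_matrix (\<lambda>z. F z - 1) n k"
  by (simp add: stirling2_F_def iteration_matrix_def)

lemma signed_stirling1_eq_iteration_matrix:
  "signed_stirling1 n k = iteration_matrix (\<lambda>z. Ln (1 + z)) n k"
  by (simp add: signed_stirling1_def iteration_matrix_def)

lemma sum_stirling2_F_stirling1_F_eq_delta:
  assumes F: "F analytic_on {0}" "F 0 = 1" and G: "G analytic_on {0}" "G 0 = 1"
    and inverse: "\<forall>\<^sub>F z in nhds 0. Ln (G (F z - 1)) = z"
  shows "(\<Sum>j=k..n. stirling2_F F n j * stirling1_F G j k) = (if n = k then 1 else 0)"
proof -
  have "(\<lambda>z. F z - 1) analytic_on {0}"
    using F(1) by (intro analytic_intros)
  then have "(\<Sum>j=k..n. stirling2_F F n j * stirling1_F G j k) =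
      iteration_matrix (\<lambda>z. Ln (G (F z - 1))) n k"
    unfolding stirling2_F_eq_iteration_matrix stirling1_F_eq_iteration_matrix
    by (subst iteration_matrix_compose[where f = "\<lambda>z. Ln (G z)"])
       (simp_all add: F G analytic_Ln_F)
  also have "\<dots> = (if n = k then 1 else 0)"
    using iteration_matrix_cong[OF inverse] by (simp add: iteration_matrix_ident)
  finally show ?thesis .
qed

lemma signed_stirling1_eq_sum_stirling1_F:
  assumes F: "F analytic_on {0}" "F 0 = 1" and G: "G analytic_on {0}" "G 0 = 1"
    and inverse: "\<forall>\<^sub>F z in nhds 0. G (Ln (F z)) = 1 + z"
  shows "signed_stirling1 n k = (\<Sum>j=k..n. stirling1_F F n j * stirling1_F G j k)"
proof -
  have "\<forall>\<^sub>F z in nhds 0. Ln (1 + z) = Ln (G (Ln (F z)))"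
    using inverse by eventually_elim simp
  then have "signed_stirling1 n k = iteration_matrix (\<lambda>z. Ln (G (Ln (F z)))) n k"
    unfolding signed_stirling1_eq_iteration_matrix by (rule iteration_matrix_cong)
  also have "\<dots> = (\<Sum>j=k..n. stirling1_F F n j * stirling1_F G j k)"
    unfolding stirling1_F_eq_iteration_matrix
    by (rule iteration_matrix_compose[where f = "\<lambda>z. Ln (G z)"])
       (simp_all add: F G analytic_Ln_F)
  finally show ?thesis .
qed

lemma falling_factorial_eq_sum_stirling1_F:
  assumes F: "F analytic_on {0}" "F 0 = 1" and G: "G analytic_on {0}" "G 0 = 1"
    and inverse: "\<forall>\<^sub>F z in nhds 0. G (Ln (F z)) = 1 + z"
  shows "(\<Prod>i<n. a - of_nat i) =
    (\<Sum>k=0..n. stirling1_F F n k * egf_coeff (\<lambda>z. G z powr a) k)"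
proof -
  have "(\<Prod>i<n. a - of_nat i) = egf_coeff (\<lambda>z. (1 + z) powr a) n"
    using egf_coeff_powr_linear[of 1 a n] by simp
  also have "\<dots> = egf_coeff (\<lambda>z. G (Ln (F z)) powr a) n"
    by (rule egf_coeff_cong) (use inverse in \<open>eventually_elim, simp\<close>)
  also have "\<dots> = (\<Sum>k=0..n. stirling1_F F n k * egf_coeff (\<lambda>z. G z powr a) k)"
    unfolding stirling1_F_eq_iteration_matrix
  proof (rule egf_coeff_compose)
    show "(\<lambda>z. G z powr a) analytic_on {0}"
      using G by (intro analytic_intros) auto
  qed (simp_all add: F analytic_Ln_F)
  finally show ?thesis .
qed

section \<open>Principal logarithms and powers near 1\<close>

lemma eventually_Ln_exp:
  assumes "(g \<longlongrightarrow> c) F" "\<bar>Im c\<bar> < pi"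
  shows "\<forall>\<^sub>F z in F. Ln (exp (g z)) = g z"
proof -
  have "((\<lambda>z. \<bar>Im (g z)\<bar>) \<longlongrightarrow> \<bar>Im c\<bar>) F"
    using assms(1) by (intro tendsto_intros)
  then have "\<forall>\<^sub>F z in F. \<bar>Im (g z)\<bar> < pi"
    using assms(2) by (rule order_tendstoD(2))
  then show ?thesis
    by eventually_elim (auto intro!: Ln_exp)
qed

lemma eventually_Ln_powr:
  fixes a :: complex
  assumes "(g \<longlongrightarrow> 1) F"
  shows "\<forall>\<^sub>F z in F. Ln (g z powr a) = a * Ln (g z)"
proof -
  have "((\<lambda>z. a * Ln (g z)) \<longlongrightarrow> a * Ln 1) F"
    using assms by (intro tendsto_intros) auto
  then have "\<forall>\<^sub>F z in F. Ln (exp (a * Ln (g z))) = a * Ln (g z)"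
    by (rule eventually_Ln_exp) simp
  moreover have "\<forall>\<^sub>F z in F. g z \<noteq> 0"
    using assms by (rule tendsto_imp_eventually_ne) simp
  ultimately show ?thesis
    by eventually_elim (simp add: powr_def)
qed

lemma eventually_powr_powr:
  fixes a b :: complex
  assumes "(g \<longlongrightarrow> 1) F"
  shows "\<forall>\<^sub>F z in F. (g z powr a) powr b = g z powr (a * b)"
  using eventually_Ln_powr[OF assms, of a]
proof eventually_elim
  case (elim z)
  then show ?case
    by (simp add: powr_def[of "g z powr a"] powr_def[of "g z" "a * b"] mult_ac)
qed

section \<open>The functions B and C\<close>

lemma tendsto_one_plus_cmult: "((\<lambda>z::complex. 1 + c * z) \<longlongrightarrow> 1) (nhds 0)"
  by (auto intro!: tendsto_eq_intros filterlim_ident)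

lemma tendsto_one_plus: "((\<lambda>z::complex. 1 + z) \<longlongrightarrow> 1) (nhds 0)"
  using tendsto_one_plus_cmult[of 1] by simp

lemma tendsto_B_fun: "(B_fun l \<longlongrightarrow> 1) (nhds 0)"
  using analytic_at_imp_isCont[OF B_fun_analytic] tendsto_at_iff_tendsto_nhds[of "B_fun l" 0]
  by (simp add: isCont_def B_fun_0)

lemma eventually_Ln_C_fun:
  "\<forall>\<^sub>F z in nhds 0. Ln (C_fun l z) = 1 / of_real l * ((1 + z) powr of_real l - 1)"
  unfolding C_fun_def
proof (rule eventually_Ln_exp)
  have "((\<lambda>z::complex. (1 + z) powr of_real l) \<longlongrightarrow> 1 powr of_real l) (nhds 0)"
    by (rule tendsto_powr_complex[OF _ tendsto_one_plus tendsto_const]) simp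
  then show "((\<lambda>z. 1 / of_real l * ((1 + z) powr of_real l - 1)) \<longlongrightarrow>
      1 / of_real l * (1 powr of_real l - 1)) (nhds (0::complex))"
    by (intro tendsto_mult tendsto_diff tendsto_const)
qed simp

lemma eventually_Ln_C_fun_B_fun:
  assumes "l \<noteq> 0"
  shows "\<forall>\<^sub>F z in nhds 0. Ln (C_fun l (B_fun l z - 1)) = z"
proof -
  have "((\<lambda>z. B_fun l z - 1) \<longlongrightarrow> 0) (nhds 0)"
    using tendsto_diff[OF tendsto_B_fun tendsto_const, of l 1] by simp
  from eventually_compose_filterlim[OF eventually_Ln_C_fun this]
  have "\<forall>\<^sub>F z in nhds 0.
      Ln (C_fun l (B_fun l z - 1)) = 1 / of_real l * (B_fun l z powr of_real l - 1)"
    by simp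
  moreover have "\<forall>\<^sub>F z in nhds 0. B_fun l z powr of_real l = (1 + of_real l * z) powr 1"
    using eventually_powr_powr[OF tendsto_one_plus_cmult, of "of_real l" "1 / of_real l" "of_real l"]
      assms by (simp add: B_fun_def)
  moreover have "\<forall>\<^sub>F z in nhds (0::complex). 1 + of_real l * z \<noteq> 0"
    by (rule tendsto_imp_eventually_ne[OF tendsto_one_plus_cmult]) simp
  ultimately show ?thesis
    by eventually_elim (simp add: assms)
qed

lemma eventually_B_fun_Ln_C_fun:
  assumes "l \<noteq> 0"
  shows "\<forall>\<^sub>F z in nhds 0. B_fun l (Ln (C_fun l z)) = 1 + z"
proof -
  have "\<forall>\<^sub>F z in nhds (0::complex).
      ((1 + z) powr of_real l) powr (1 / of_real l) = (1 + z) powr 1"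
    using eventually_powr_powr[OF tendsto_one_plus, of "of_real l" "1 / of_real l"] assms by simp
  moreover have "\<forall>\<^sub>F z in nhds (0::complex). 1 + z \<noteq> 0"
    by (rule tendsto_imp_eventually_ne[OF tendsto_one_plus]) simp
  ultimately show ?thesis
    using eventually_Ln_C_fun[of l] by eventually_elim (simp add: B_fun_def assms)
qed

lemma stirling1_F_B_fun:
  assumes "l \<noteq> 0" "k \<le> n"
  shows "stirling1_F (B_fun l) n k = of_real l ^ (n - k) * signed_stirling1 n k"
proof -
  have "\<forall>\<^sub>F z in nhds 0. Ln (B_fun l z) = Ln (1 + of_real l * z) / of_real l"
    using eventually_Ln_powr[OF tendsto_one_plus_cmult, of "of_real l" "1 / of_real l"]
    by (simp add: B_fun_def)
  then have "stirling1_F (B_fun l) n k =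
      iteration_matrix (\<lambda>z. Ln (1 + of_real l * z) / of_real l) n k"
    unfolding stirling1_F_eq_iteration_matrix by (rule iteration_matrix_cong)
  also have "\<dots> = of_real l ^ (n - k) * signed_stirling1 n k"
    unfolding signed_stirling1_eq_iteration_matrix
    by (rule iteration_matrix_rescale) (use assms in \<open>auto intro!: analytic_intros\<close>)
  finally show ?thesis .
qed

lemma egf_coeff_B_fun_powr:
  assumes "l \<noteq> 0"
  shows "egf_coeff (\<lambda>z. B_fun l z powr of_real x) k = of_real (ffact_step x k l)"
proof -
  have "\<forall>\<^sub>F z in nhds 0. B_fun l z powr of_real x = (1 + of_real l * z) powr of_real (x / l)"
    using eventually_powr_powr[OF tendsto_one_plus_cmult, of "of_real l" "1 / of_real l" "of_real x"]
    by (simp add: B_fun_def)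
  then have "egf_coeff (\<lambda>z. B_fun l z powr of_real x) k =
      (\<Prod>i<k. of_real l * (of_real (x / l) - of_nat i))"
    by (simp add: egf_coeff_cong egf_coeff_powr_linear)
  also have "\<dots> = of_real (ffact_step x k l)"
    using assms by (simp add: ffact_step_def right_diff_distrib mult.commute)
  finally show ?thesis .
qed

theorem theorem13:
  fixes l :: real
  assumes "l \<noteq> 0"
  shows "(\<forall>n k. k \<le> n \<longrightarrow>
            (if n = k then 1 else 0) =
              (\<Sum>j=k..n. stirling2_F (B_fun l) n j * stirling1_F (C_fun l) j k) \<and>
            signed_stirling1 n k =
              (\<Sum>j=k..n. stirling1_F (C_fun l) n j * of_real l ^ (j - k) * signed_stirling1 j k)) \<and>
         (\<forall>n (x::real).
            complex_of_real (ffact x n) =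
              (\<Sum>k=0..n. stirling1_F (C_fun l) n k * of_real (ffact_step x k l)))"
proof (intro conjI allI impI)
  note B = B_fun_analytic[of l] B_fun_0[of l] and C = C_fun_analytic[of l] C_fun_0[of l]
  note B_Ln_C = eventually_B_fun_Ln_C_fun[OF assms]
  fix n k :: nat and x :: real
  show "(if n = k then 1 else 0) =
      (\<Sum>j=k..n. stirling2_F (B_fun l) n j * stirling1_F (C_fun l) j k)"
    using sum_stirling2_F_stirling1_F_eq_delta[OF B C eventually_Ln_C_fun_B_fun[OF assms]] by simp
  show "signed_stirling1 n k =
      (\<Sum>j=k..n. stirling1_F (C_fun l) n j * of_real l ^ (j - k) * signed_stirling1 j k)"
    using signed_stirling1_eq_sum_stirling1_F[OF C B B_Ln_C, of n k]
    by (simp add: stirling1_F_B_fun[OF assms] mult.assoc)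
  show "complex_of_real (ffact x n) =
      (\<Sum>k=0..n. stirling1_F (C_fun l) n k * of_real (ffact_step x k l))"
    using falling_factorial_eq_sum_stirling1_F[OF C B B_Ln_C, where n = n and a = "of_real x"]
    by (simp add: egf_coeff_B_fun_powr[OF assms] ffact_def)
qed

end
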